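(* Let $H(z)\in\mathbb{C}[[z]]^{\times n}$ with $o(H(z))\ge 2$, and let $\{N_{[m]}(z)\mid m\ge 1\}$ be the sequence in $\mathbb{C}[[z]]^{\times n}$ defined recurrently by $$N_{[1]}=H,\qquad N_{[m]}=\frac{1}{m-1}\sum_{\substack{k+l=m\\ k,l\ge 1}}JN_{[k]}\cdot N_{[l]}\quad (m\ge 2).$$ Then the formal inverse of $F(z)=z-H(z)$ is given by $$G(z)=z+\sum_{m=1}^\infty N_{[m]}(z).$$
   Context: $z=(z_1,\dots,z_n)$. Elements of $\mathbb{C}[[z]]^{\times n}$ are column vectors of $n$ formal power series. $o(H(z))\ge 2$ means every monomial occurring in any component of $H$ has total degree at least $2$. For a vector $U$ of series, $JU=(\partial U_i/\partial z_j)_{i,j}$ is the Jacobian matrix and $JU\cdot V$ is the matrix-vector product. The formal inverse $G$ of $F$ is the formal map with $F(G(z))=G(F(z))=z$. The infinite sum is taken in the usual topology on formal power series (each coefficient of a monomial receives only finitely many nonzero contributions). *)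

theory Defs
  imports "HOL-Analysis.Analysis"
begin

text \<open>
  Formal power series over \<open>'a\<close> in finitely many commuting variables \<open>z\<^sub>i\<close>, \<open>i :: 'n\<close>.
  The exponent vector \<open>a :: nat ^ 'n\<close> stands for the monomial \<open>\<Prod>i. z\<^sub>i ^ (a $ i)\<close>.
\<close>

typedef ('a, 'n::finite) mfps = "UNIV :: (nat ^ 'n \<Rightarrow> 'a) set"
  morphisms mfps_coeff Abs_mfps
  by simp

lemma mfps_coeff_Abs [simp]: "mfps_coeff (Abs_mfps f) = f"
  by (simp add: Abs_mfps_inverse)

lemma mfps_eq_iff: "f = g \<longleftrightarrow> (\<forall>a. mfps_coeff f a = mfps_coeff g a)"
  by (metis mfps_coeff_inject ext)

lemma mfps_eqI: "(\<And>a. mfps_coeff f a = mfps_coeff g a) \<Longrightarrow> f = g"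
  by (simp add: mfps_eq_iff)

definition total_degree :: "nat ^ 'n::finite \<Rightarrow> nat" where
  "total_degree a = (\<Sum>i\<in>UNIV. a $ i)"

definition splittings :: "nat ^ 'n::finite \<Rightarrow> ((nat ^ 'n) \<times> (nat ^ 'n)) set" where
  "splittings c = {(a, b). a + b = c}"

lemma finite_total_degree_le: "finite {a :: nat ^ 'n::finite. total_degree a \<le> d}"
proof -
  have "{a :: nat ^ 'n. total_degree a \<le> d} \<subseteq> vec_lambda ` (Pi\<^sub>E UNIV (\<lambda>_. {..d}))"
  proof
    fix a :: "nat ^ 'n" assume a: "a \<in> {a. total_degree a \<le> d}"
    have "a $ i \<le> d" for i
      using a member_le_sum[of i UNIV "($) a"] by (simp add: total_degree_def)
    then have "($) a \<in> Pi\<^sub>E UNIV (\<lambda>_. {..d})" by auto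
    then show "a \<in> vec_lambda ` (Pi\<^sub>E UNIV (\<lambda>_. {..d}))"
      by (metis image_eqI vec_nth_inverse)
  qed
  then show ?thesis
    by (rule finite_subset) (intro finite_imageI finite_PiE; simp)
qed

lemma total_degree_add: "total_degree (a + b) = total_degree a + total_degree b"
  by (simp add: total_degree_def sum.distrib)

lemma finite_splittings [simp]: "finite (splittings c)"
proof (rule finite_subset)
  let ?A = "{a. total_degree a \<le> total_degree c}"
  show "splittings c \<subseteq> ?A \<times> ?A"
    by (auto simp: splittings_def total_degree_add)
  show "finite (?A \<times> ?A)"
    by (intro finite_cartesian_product finite_total_degree_le)
qed

instantiation mfps :: (comm_ring_1, finite) comm_ring_1
begin

definition "0 = Abs_mfps (\<lambda>_. 0)"
definition "1 = Abs_mfps (\<lambda>a. if a = 0 then 1 else 0)"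
definition "f + g = Abs_mfps (\<lambda>a. mfps_coeff f a + mfps_coeff g a)"
definition "- f = Abs_mfps (\<lambda>a. - mfps_coeff f a)"
definition "f - g = Abs_mfps (\<lambda>a. mfps_coeff f a - mfps_coeff g a)"
definition "f * g = Abs_mfps (\<lambda>c. \<Sum>(a, b)\<in>splittings c. mfps_coeff f a * mfps_coeff g b)"

instance
proof
  fix f g h :: "('a, 'b) mfps"
  show "f + g + h = f + (g + h)" "f + g = g + f" "0 + f = f" "- f + f = 0" "f - g = f + - g"
    by (auto simp: plus_mfps_def zero_mfps_def uminus_mfps_def minus_mfps_def mfps_eq_iff)
  show "(0 :: ('a, 'b) mfps) \<noteq> 1"
    by (auto simp: zero_mfps_def one_mfps_def mfps_eq_iff)
  show "(f + g) * h = f * h + g * h"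
    by (simp add: plus_mfps_def times_mfps_def mfps_eq_iff algebra_simps case_prod_unfold
        sum.distrib)
  show "f * g = g * f"
  proof (rule mfps_eqI)
    fix c
    show "mfps_coeff (f * g) c = mfps_coeff (g * f) c"
      unfolding times_mfps_def mfps_coeff_Abs
      by (rule sum.reindex_bij_witness[of _ prod.swap prod.swap])
        (auto simp: splittings_def algebra_simps)
  qed
  show "1 * f = f"
  proof (rule mfps_eqI)
    fix c
    have "mfps_coeff (1 * f) c = (\<Sum>(a, b)\<in>{(0, c)}. mfps_coeff 1 a * mfps_coeff f b)"
      unfolding times_mfps_def mfps_coeff_Abs
      by (rule sum.mono_neutral_right[OF finite_splittings])
        (auto simp: splittings_def one_mfps_def split: if_splits)
    then show "mfps_coeff (1 * f) c = mfps_coeff f c"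
      by (simp add: one_mfps_def)
  qed
  show "f * g * h = f * (g * h)"
  proof (rule mfps_eqI)
    fix d
    let ?f = "mfps_coeff f" and ?g = "mfps_coeff g" and ?h = "mfps_coeff h"
    have "mfps_coeff (f * g * h) d =
        (\<Sum>(p, q)\<in>(SIGMA p:splittings d. splittings (fst p)). ?f (fst q) * ?g (snd q) * ?h (snd p))"
      by (simp add: times_mfps_def case_prod_unfold sum_distrib_right sum.Sigma)
    also have "\<dots> =
        (\<Sum>(p, q)\<in>(SIGMA p:splittings d. splittings (snd p)). ?f (fst p) * (?g (fst q) * ?h (snd q)))"
      by (rule sum.reindex_bij_witness
          [of _ "\<lambda>(p, q). ((fst p + fst q, snd q), (fst p, fst q))"
              "\<lambda>(p, q). ((fst q, snd q + snd p), (snd q, snd p))"])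
        (auto simp: splittings_def algebra_simps)
    also have "\<dots> = mfps_coeff (f * (g * h)) d"
      by (simp add: times_mfps_def case_prod_unfold sum_distrib_left sum.Sigma)
    finally show "mfps_coeff (f * g * h) d = mfps_coeff (f * (g * h)) d" .
  qed
qed

end

text \<open>
  The usual topology: a neighbourhood of \<open>f\<close> prescribes finitely many coefficients. Hence a
  sequence converges iff each coefficient is eventually constant, and a series converges iff each
  monomial receives only finitely many nonzero contributions. Vectors of series carry the product
  topology.
\<close>

instantiation mfps :: (type, finite) t2_space
begin

definition open_mfps :: "('a, 'b) mfps set \<Rightarrow> bool" where
  "open_mfps U \<longleftrightarrow> (\<forall>f\<in>U. \<exists>d. \<forall>g.
     (\<forall>a. total_degree a \<le> d \<longrightarrow> mfps_coeff g a = mfps_coeff f a) \<longrightarrow> g \<in> U)"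

instance
proof
  show "open (UNIV :: ('a, 'b) mfps set)"
    by (simp add: open_mfps_def)
  fix S T :: "('a, 'b) mfps set"
  assume S: "open S" and T: "open T"
  show "open (S \<inter> T)"
    unfolding open_mfps_def
  proof
    fix f assume f: "f \<in> S \<inter> T"
    obtain d where d:
      "\<And>g. (\<forall>a. total_degree a \<le> d \<longrightarrow> mfps_coeff g a = mfps_coeff f a) \<Longrightarrow> g \<in> S"
      using S f unfolding open_mfps_def by blast
    obtain e where e:
      "\<And>g. (\<forall>a. total_degree a \<le> e \<longrightarrow> mfps_coeff g a = mfps_coeff f a) \<Longrightarrow> g \<in> T"
      using T f unfolding open_mfps_def by blast
    have "g \<in> S \<inter> T"
      if "\<forall>a. total_degree a \<le> max d e \<longrightarrow> mfps_coeff g a = mfps_coeff f a" for g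
      using that d[of g] e[of g] by simp
    then show "\<exists>d. \<forall>g. (\<forall>a. total_degree a \<le> d \<longrightarrow> mfps_coeff g a = mfps_coeff f a)
        \<longrightarrow> g \<in> S \<inter> T"
      by blast
  qed
next
  fix K :: "('a, 'b) mfps set set"
  assume K: "\<forall>S\<in>K. open S"
  show "open (\<Union>K)"
    unfolding open_mfps_def
  proof
    fix f assume "f \<in> \<Union>K"
    then obtain S where S: "S \<in> K" "f \<in> S" by blast
    then obtain d where
      "\<forall>g. (\<forall>a. total_degree a \<le> d \<longrightarrow> mfps_coeff g a = mfps_coeff f a) \<longrightarrow> g \<in> S"
      using K unfolding open_mfps_def by blast
    with S show "\<exists>d. \<forall>g. (\<forall>a. total_degree a \<le> d \<longrightarrow> mfps_coeff g a = mfps_coeff f a)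
        \<longrightarrow> g \<in> \<Union>K"
      by blast
  qed
next
  fix f g :: "('a, 'b) mfps"
  assume "f \<noteq> g"
  then obtain a where a: "mfps_coeff f a \<noteq> mfps_coeff g a"
    by (auto simp: mfps_eq_iff)
  have *: "open {h :: ('a, 'b) mfps. mfps_coeff h a = c}" for c
    unfolding open_mfps_def by (auto intro!: exI[of _ "total_degree a"])
  show "\<exists>U V. open U \<and> open V \<and> f \<in> U \<and> g \<in> V \<and> U \<inter> V = {}"
    by (rule exI[of _ "{h. mfps_coeff h a = mfps_coeff f a}"],
        rule exI[of _ "{h. mfps_coeff h a = mfps_coeff g a}"]) (use a * in auto)
qed

end

definition mfps_const :: "'a::zero \<Rightarrow> ('a, 'n::finite) mfps" where
  "mfps_const c = Abs_mfps (\<lambda>a. if a = 0 then c else 0)"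

definition mfps_var :: "'n::finite \<Rightarrow> ('a::zero_neq_one, 'n) mfps" where
  "mfps_var i = Abs_mfps (\<lambda>a. if a = axis i 1 then 1 else 0)"

definition mfps_deriv :: "'n::finite \<Rightarrow> ('a::semiring_1, 'n) mfps \<Rightarrow> ('a, 'n) mfps" where
  "mfps_deriv i f = Abs_mfps (\<lambda>a. of_nat (a $ i + 1) * mfps_coeff f (a + axis i 1))"

definition jacobian_matrix :: "(('a::semiring_1, 'n::finite) mfps) ^ 'm \<Rightarrow> (('a, 'n) mfps) ^ 'n ^ 'm"
  where "jacobian_matrix U = (\<chi> i j. mfps_deriv j (U $ i))"

definition order_ge :: "nat \<Rightarrow> (('a::zero, 'n::finite) mfps) ^ 'm \<Rightarrow> bool" where
  "order_ge d U \<longleftrightarrow> (\<forall>i a. mfps_coeff (U $ i) a \<noteq> 0 \<longrightarrow> d \<le> total_degree a)"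

text \<open>
  Substitution \<open>f(V) = \<Sum>a. f\<^sub>a V\<^sup>a\<close>, taken coefficientwise; it is meaningful when \<open>V\<close> has no
  constant terms, since then only finitely many \<open>a\<close> contribute to each coefficient.
\<close>

definition mfps_subst ::
  "('a::comm_ring_1, 'n::finite) mfps \<Rightarrow> (('a, 'k::finite) mfps) ^ 'n \<Rightarrow> ('a, 'k) mfps" where
  "mfps_subst f V = Abs_mfps (\<lambda>b.
     let t = (\<lambda>a. mfps_coeff f a * mfps_coeff (\<Prod>i\<in>UNIV. (V $ i) ^ (a $ i)) b)
     in \<Sum>a | t a \<noteq> 0. t a)"

definition formal_compose ::
  "(('a::comm_ring_1, 'n::finite) mfps) ^ 'm \<Rightarrow> (('a, 'k::finite) mfps) ^ 'n \<Rightarrow> (('a, 'k) mfps) ^ 'm"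
  where "formal_compose U V = (\<chi> i. mfps_subst (U $ i) V)"

definition formal_id :: "(('a::zero_neq_one, 'n::finite) mfps) ^ 'n" where
  "formal_id = (\<chi> i. mfps_var i)"

definition formal_inverse ::
  "(('a::comm_ring_1, 'n::finite) mfps) ^ 'n \<Rightarrow> (('a, 'n) mfps) ^ 'n \<Rightarrow> bool" where
  "formal_inverse F G \<longleftrightarrow> order_ge 1 F \<and> order_ge 1 G \<and>
     formal_compose F G = formal_id \<and> formal_compose G F = formal_id"

end

theory Submission
  imports Defs "HOL-Computational_Algebra.Polynomial"
begin

text \<open>
  Introduce a parameter \<open>t\<close> and put \<open>N\<^sub>t = \<Sum>m. t\<^sup>m N\<^bsub>[m+1]\<^esub>\<close>. Comparing powers of \<open>t\<close>, the
  recurrence for the \<open>N\<^bsub>[m]\<^esub>\<close> says exactly that \<open>N\<^sub>t\<close> solves the initial value problem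
  \<open>\<partial>N\<^sub>t/\<partial>t = JN\<^sub>t \<cdot> N\<^sub>t\<close>, \<open>N\<^sub>0 = H\<close> (\<open>mfps_pderiv_deformation\<close>, \<open>coeff_deformation\<close>). Substitute the
  map \<open>F\<^sub>t = z - t H\<close> and consider \<open>Z\<^sub>t = N\<^sub>t(F\<^sub>t) - H\<close>. Since \<open>\<partial>F\<^sub>t/\<partial>t = -H\<close>, the chain rule
  \<open>mfps_pderiv_subst\<close> gives
  \<open>\<partial>Z\<^sub>t/\<partial>t = JN\<^sub>t(F\<^sub>t) \<cdot> N\<^sub>t(F\<^sub>t) - JN\<^sub>t(F\<^sub>t) \<cdot> H = JN\<^sub>t(F\<^sub>t) \<cdot> Z\<^sub>t\<close>.
  This is a homogeneous linear equation with \<open>Z\<^sub>0 = N\<^sub>0(z) - H = 0\<close>, so \<open>Z\<^sub>t = 0\<close>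
  (\<open>linear_system_unique\<close>). At \<open>t = 1\<close> this reads \<open>N\<^sub>1(z - H) = H\<close>, that is, \<open>z + N\<^sub>1\<close> is a left
  inverse of \<open>F = z - H\<close> for composition (\<open>inversion_sum_left_inverse\<close>).

  Setting \<open>t = 1\<close> is legitimate because \<open>N\<^bsub>[m]\<^esub>\<close> has order at least \<open>m + 1\<close>: every coefficient of
  \<open>N\<^sub>t\<close> is a polynomial in \<open>t\<close>. The deformation therefore lives in power series over the polynomial
  ring, and \<open>t = 0\<close>, \<open>t = 1\<close> are ring homomorphisms applied to the coefficients. The same bound on
  the order makes the series converge.

  A left inverse \<open>G\<close> is a right inverse because it has the same shape \<open>z - H'\<close> with \<open>H'\<close> of order at
  least two, so it has a left inverse \<open>K\<close> itself; associativity of composition forces \<open>K = F\<close>. The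
  calculus of substitution that this rests on (multiplicativity, associativity, chain rule) follows
  from the density of polynomials, \<open>mfps_operator_eqI\<close>.
\<close>

section \<open>Coefficients and orders\<close>

(* Hypotheses of the form order_ge 1 V must survive simplification to be usable as rewrite
   conditions. *)
declare One_nat_def [simp del]

lemma mfps_coeff_arith [simp]:
  "mfps_coeff 0 a = 0"
  "mfps_coeff (f + g) a = mfps_coeff f a + mfps_coeff g a"
  "mfps_coeff (f - g) a = mfps_coeff f a - mfps_coeff g a"
  "mfps_coeff (- f) a = - mfps_coeff f a"
  by (simp_all add: zero_mfps_def plus_mfps_def minus_mfps_def uminus_mfps_def)

lemma mfps_coeff_mult:
  "mfps_coeff (f * g) c = (\<Sum>(a, b)\<in>splittings c. mfps_coeff f a * mfps_coeff g b)"
  by (simp add: times_mfps_def)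

lemma mfps_coeff_sum [simp]: "mfps_coeff (sum f S) a = (\<Sum>x\<in>S. mfps_coeff (f x) a)"
  by (induction S rule: infinite_finite_induct) auto

lemma mfps_coeff_const_mult [simp]:
  fixes f :: "('a::comm_ring_1, 'n::finite) mfps"
  shows "mfps_coeff (mfps_const c * f) a = c * mfps_coeff f a"
proof -
  have "mfps_coeff (mfps_const c * f) a =
      (\<Sum>(p, q)\<in>{(0 :: nat ^ 'n, a)}. mfps_coeff (mfps_const c) p * mfps_coeff f q)"
    unfolding mfps_coeff_mult
    by (rule sum.mono_neutral_right[OF finite_splittings])
      (auto simp: splittings_def mfps_const_def split: if_splits)
  then show ?thesis by (simp add: mfps_const_def)
qed

lemma mfps_const_1 [simp]: "mfps_const 1 = 1"
  by (simp add: mfps_const_def one_mfps_def)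

lemma mfps_const_0 [simp]: "mfps_const 0 = 0"
  by (simp add: mfps_const_def zero_mfps_def)

lemma mfps_const_mult: "mfps_const (c * d) = mfps_const c * mfps_const d"
  by (rule mfps_eqI) (simp only: mfps_coeff_const_mult, simp add: mfps_const_def)

definition vanishes_below :: "nat \<Rightarrow> ('a::zero, 'n::finite) mfps \<Rightarrow> bool" where
  "vanishes_below d f \<longleftrightarrow> (\<forall>a. total_degree a < d \<longrightarrow> mfps_coeff f a = 0)"

lemma order_ge_iff_vanishes_below: "order_ge d U \<longleftrightarrow> (\<forall>i. vanishes_below d (U $ i))"
  unfolding order_ge_def vanishes_below_def by (meson not_le)

lemma vanishes_below_mono: "vanishes_below e f \<Longrightarrow> d \<le> e \<Longrightarrow> vanishes_below d f"
  unfolding vanishes_below_def by simp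

lemma vanishes_below_add:
  fixes f g :: "('a::comm_ring_1, 'n::finite) mfps"
  shows "vanishes_below d f \<Longrightarrow> vanishes_below d g \<Longrightarrow> vanishes_below d (f + g)"
  unfolding vanishes_below_def by simp

lemma vanishes_below_sum:
  fixes f :: "'b \<Rightarrow> ('a::comm_ring_1, 'n::finite) mfps"
  shows "(\<And>x. x \<in> S \<Longrightarrow> vanishes_below d (f x)) \<Longrightarrow> vanishes_below d (sum f S)"
  unfolding vanishes_below_def by simp

text \<open>
  If \<open>a + b\<close> has total degree below \<open>d + e\<close>, then \<open>a\<close> lies below \<open>d\<close> or \<open>b\<close> lies below \<open>e\<close>, so each
  term of the Cauchy product has a vanishing factor.
\<close>

lemma vanishes_below_mult:
  fixes f g :: "('a::comm_ring_1, 'n::finite) mfps"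
  assumes "vanishes_below d f" "vanishes_below e g"
  shows "vanishes_below (d + e) (f * g)"
  unfolding vanishes_below_def
proof (intro allI impI)
  fix c :: "nat ^ 'n" assume c: "total_degree c < d + e"
  have "mfps_coeff f a * mfps_coeff g b = 0" if "a + b = c" for a b
  proof -
    have "total_degree a + total_degree b < d + e"
      using c that total_degree_add[of a b] by simp
    then have "total_degree a < d \<or> total_degree b < e" by linarith
    then show ?thesis using assms by (auto simp: vanishes_below_def)
  qed
  then show "mfps_coeff (f * g) c = 0"
    unfolding mfps_coeff_mult by (intro sum.neutral) (auto simp: splittings_def)
qed

lemma vanishes_below_mult_left:
  fixes f g :: "('a::comm_ring_1, 'n::finite) mfps"
  shows "vanishes_below d f \<Longrightarrow> vanishes_below d (f * g)"
  using vanishes_below_mult[of d f 0 g] by (simp add: vanishes_below_def)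

lemma vanishes_below_mult_right:
  fixes f g :: "('a::comm_ring_1, 'n::finite) mfps"
  shows "vanishes_below d g \<Longrightarrow> vanishes_below d (f * g)"
  using vanishes_below_mult_left[of d g f] by (simp add: mult.commute)

lemma vanishes_below_power:
  fixes f :: "('a::comm_ring_1, 'n::finite) mfps"
  assumes "vanishes_below 1 f"
  shows "vanishes_below n (f ^ n)"
proof (induction n)
  case (Suc n)
  then show ?case using vanishes_below_mult[OF assms Suc] by (simp add: One_nat_def)
qed (simp add: vanishes_below_def)

lemma mfps_coeff_deriv:
  "mfps_coeff (mfps_deriv i f) a = of_nat (a $ i + 1) * mfps_coeff f (a + axis i 1)"
  by (simp add: mfps_deriv_def)

lemma total_degree_axis [simp]: "total_degree (axis i k :: nat ^ 'n::finite) = k"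
  by (simp add: total_degree_def axis_def)

lemma vanishes_below_deriv:
  fixes f :: "('a::comm_ring_1, 'n::finite) mfps"
  shows "vanishes_below (Suc d) f \<Longrightarrow> vanishes_below d (mfps_deriv i f)"
  unfolding vanishes_below_def by (simp add: mfps_coeff_deriv total_degree_add)

section \<open>Monomials and density of polynomials\<close>

definition vec_power :: "('r::comm_monoid_mult) ^ 'n::finite \<Rightarrow> nat ^ 'n \<Rightarrow> 'r" where
  "vec_power V a = (\<Prod>i\<in>UNIV. (V $ i) ^ (a $ i))"

lemma vec_power_0 [simp]: "vec_power V 0 = 1"
  by (simp add: vec_power_def)

lemma vec_power_add: "vec_power V (a + b) = vec_power V a * vec_power V b"
  by (simp add: vec_power_def power_add prod.distrib)

lemma vec_power_axis [simp]: "vec_power V (axis i 1) = V $ i"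
proof -
  have "vec_power V (axis i 1) = (\<Prod>j\<in>UNIV. if j = i then V $ j else 1)"
    unfolding vec_power_def by (rule prod.cong) (auto simp: axis_def)
  then show ?thesis by simp
qed

lemma vanishes_below_vec_power:
  fixes V :: "(('a::comm_ring_1, 'k::finite) mfps) ^ 'n::finite"
  assumes "order_ge 1 V"
  shows "vanishes_below (total_degree a) (vec_power V a)"
proof -
  have "vanishes_below (\<Sum>i\<in>S. a $ i) (\<Prod>i\<in>S. (V $ i) ^ (a $ i))" if "finite S" for S
    using that
  proof (induction S rule: finite_induct)
    case (insert i S)
    then show ?case
      using assms vanishes_below_mult[OF vanishes_below_power insert.IH]
      by (simp add: order_ge_iff_vanishes_below)
  qed (simp add: vanishes_below_def)
  then show ?thesis by (simp add: vec_power_def total_degree_def)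
qed

definition mfps_monom :: "nat ^ 'n::finite \<Rightarrow> ('a::zero_neq_one, 'n) mfps" where
  "mfps_monom a = Abs_mfps (\<lambda>b. if b = a then 1 else 0)"

lemma mfps_coeff_monom: "mfps_coeff (mfps_monom a) b = (if b = a then 1 else 0)"
  by (simp add: mfps_monom_def)

lemma mfps_monom_0: "mfps_monom 0 = 1"
  by (simp add: mfps_monom_def one_mfps_def)

lemma mfps_monom_axis: "mfps_monom (axis i 1) = mfps_var i"
  by (simp add: mfps_monom_def mfps_var_def)

lemma mfps_monom_add:
  "mfps_monom (a + b) = mfps_monom a * (mfps_monom b :: ('a::comm_ring_1, 'n::finite) mfps)"
proof (rule mfps_eqI)
  fix c
  have "mfps_coeff (mfps_monom a * (mfps_monom b :: ('a, 'n) mfps)) c =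
      (\<Sum>p\<in>splittings c. if p = (a, b) then 1 else 0)"
    unfolding mfps_coeff_mult by (rule sum.cong) (auto simp: mfps_coeff_monom split: if_splits)
  also have "\<dots> = (if c = a + b then 1 else 0)"
    by (simp only: sum.delta[OF finite_splittings]) (auto simp: splittings_def)
  finally show "mfps_coeff (mfps_monom (a + b)) c =
      mfps_coeff (mfps_monom a * (mfps_monom b :: ('a, 'n) mfps)) c"
    by (simp add: mfps_coeff_monom)
qed

lemma vec_power_formal_id:
  "vec_power formal_id a = (mfps_monom a :: ('a::comm_ring_1, 'n::finite) mfps)"
proof -
  have pow: "mfps_var i ^ k = (mfps_monom (axis i k) :: ('a, 'n) mfps)" for i :: 'n and k
  proof (induction k)
    case 0
    have "axis i 0 = (0 :: nat ^ 'n)" by (simp add: vec_eq_iff axis_def)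
    then show ?case by (simp only: power_0 mfps_monom_0)
  next
    case (Suc k)
    have "axis i (Suc k) = axis i 1 + (axis i k :: nat ^ 'n)" by (simp add: vec_eq_iff axis_def)
    then show ?case by (simp only: power_Suc Suc mfps_monom_add mfps_monom_axis)
  qed
  have "(\<Prod>i\<in>S. mfps_monom (axis i (a $ i))) =
      (mfps_monom (\<Sum>i\<in>S. axis i (a $ i)) :: ('a, 'n) mfps)" if "finite S" for S
    using that
    by (induction S rule: finite_induct) (simp_all add: mfps_monom_0 mfps_monom_add)
  moreover have "(\<Sum>i\<in>UNIV. axis i (a $ i)) = a"
    by (simp add: vec_eq_iff axis_def)
  ultimately show ?thesis
    by (simp add: vec_power_def formal_id_def pow)
qed

text \<open>
  Polynomials are dense: an additive operator that lowers orders by at most one is determined by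
  its values on monomials. The loss of one order is permitted so that derivations qualify.
\<close>

lemma mfps_operator_eqI_monom:
  fixes L R :: "('a::comm_ring_1, 'n::finite) mfps \<Rightarrow> ('b::comm_ring_1, 'k::finite) mfps"
  assumes L_add: "\<And>f g. L (f + g) = L f + L g"
    and R_add: "\<And>f g. R (f + g) = R f + R g"
    and L_order: "\<And>f d. vanishes_below (Suc d) f \<Longrightarrow> vanishes_below d (L f)"
    and R_order: "\<And>f d. vanishes_below (Suc d) f \<Longrightarrow> vanishes_below d (R f)"
    and monom: "\<And>c a. L (mfps_const c * mfps_monom a) = R (mfps_const c * mfps_monom a)"
  shows "L f = R f"
proof (rule mfps_eqI)
  fix b :: "nat ^ 'k"
  (* The truncation must reach one degree beyond b, because L and R may lose one order. *)
  define S where "S = {a :: nat ^ 'n. total_degree a \<le> Suc (total_degree b)}"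
  have S: "finite S" unfolding S_def by (rule finite_total_degree_le)
  define p where "p = (\<Sum>a\<in>S. mfps_const (mfps_coeff f a) * mfps_monom a)"
  have "Modules.additive L" "Modules.additive R" by (simp_all add: Modules.additive_def L_add R_add)
  then have p: "L p = R p"
    by (simp add: p_def monom Modules.additive.sum)
  have "mfps_coeff p a = (if a \<in> S then mfps_coeff f a else 0)" for a
    using S by (simp add: p_def mfps_coeff_monom if_distrib[of "\<lambda>x. _ * x"] cong: if_cong)
  then have tail: "vanishes_below (Suc (Suc (total_degree b))) (f - p)"
    by (auto simp: vanishes_below_def S_def)
  have "mfps_coeff (L (f - p)) b = 0" "mfps_coeff (R (f - p)) b = 0"
    using L_order[OF tail] R_order[OF tail] by (simp_all add: vanishes_below_def)
  moreover have "L f = L (f - p) + L p" "R f = R (f - p) + R p"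
    by (simp_all flip: L_add R_add)
  ultimately show "mfps_coeff (L f) b = mfps_coeff (R f) b"
    by (simp add: p)
qed

text \<open>
  The same density argument for operators that respect products, where constants and variables
  suffice because they generate the polynomials.
\<close>

lemma mfps_operator_eqI:
  fixes L R :: "('a::comm_ring_1, 'n::finite) mfps \<Rightarrow> ('b::comm_ring_1, 'k::finite) mfps"
  assumes L_add: "\<And>f g. L (f + g) = L f + L g"
    and R_add: "\<And>f g. R (f + g) = R f + R g"
    and L_order: "\<And>f d. vanishes_below (Suc d) f \<Longrightarrow> vanishes_below d (L f)"
    and R_order: "\<And>f d. vanishes_below (Suc d) f \<Longrightarrow> vanishes_below d (R f)"
    and const: "\<And>c. L (mfps_const c) = R (mfps_const c)"
    and var: "\<And>i. L (mfps_var i) = R (mfps_var i)"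
    and mult: "\<And>f g. L f = R f \<Longrightarrow> L g = R g \<Longrightarrow> L (f * g) = R (f * g)"
  shows "L f = R f"
proof (rule mfps_operator_eqI_monom[of L R, OF L_add R_add L_order R_order])
  fix c :: 'a and a :: "nat ^ 'n"
  have one: "L 1 = R 1" using const[of 1] by simp
  have pow: "L (mfps_var i ^ k) = R (mfps_var i ^ k)" for i k
    by (induction k) (simp_all add: one mult var)
  have "L (\<Prod>i\<in>S. mfps_var i ^ (a $ i)) = R (\<Prod>i\<in>S. mfps_var i ^ (a $ i))" if "finite S" for S
    using that by (induction S rule: finite_induct) (simp_all add: one mult pow)
  then have "L (mfps_monom a) = R (mfps_monom a)"
    by (simp flip: vec_power_formal_id add: vec_power_def formal_id_def)
  then show "L (mfps_const c * mfps_monom a) = R (mfps_const c * mfps_monom a)"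
    by (intro mult const)
qed

section \<open>Substitution\<close>

text \<open>
  A closed form of the defining sum: \<open>V\<^sup>a\<close> has order at least the total degree of \<open>a\<close>, so the index
  set can be taken independent of \<open>f\<close> and \<open>V\<close>. This makes additivity in \<open>f\<close> evident.
\<close>

lemma mfps_coeff_subst:
  fixes V :: "(('a::comm_ring_1, 'k::finite) mfps) ^ 'n::finite"
  assumes "order_ge 1 V"
  shows "mfps_coeff (mfps_subst f V) b =
    (\<Sum>a | total_degree a \<le> total_degree b. mfps_coeff f a * mfps_coeff (vec_power V a) b)"
proof -
  have "total_degree a \<le> total_degree b" if "mfps_coeff (vec_power V a) b \<noteq> 0" for a
    using vanishes_below_vec_power[OF assms, of a] that by (meson not_le vanishes_below_def)
  then show ?thesis
    unfolding mfps_subst_def Let_def mfps_coeff_Abs vec_power_def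
    by (intro sum.mono_neutral_left finite_total_degree_le) force+
qed

lemma mfps_subst_add:
  "order_ge 1 V \<Longrightarrow> mfps_subst (f + g) V = mfps_subst f V + mfps_subst g V"
  by (rule mfps_eqI) (simp add: mfps_coeff_subst distrib_right sum.distrib)

lemma mfps_subst_0 [simp]: "mfps_subst 0 V = 0"
  by (simp add: mfps_eq_iff mfps_subst_def)

lemma mfps_subst_sum:
  "order_ge 1 V \<Longrightarrow> mfps_subst (sum f S) V = (\<Sum>x\<in>S. mfps_subst (f x) V)"
  by (induction S rule: infinite_finite_induct) (simp_all add: mfps_subst_add)

lemma vanishes_below_subst:
  "order_ge 1 V \<Longrightarrow> vanishes_below d f \<Longrightarrow> vanishes_below d (mfps_subst f V)"
  by (auto simp: vanishes_below_def mfps_coeff_subst intro!: sum.neutral)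

lemma mfps_subst_monom:
  assumes "order_ge 1 V"
  shows "mfps_subst (mfps_const c * mfps_monom a) V = mfps_const c * vec_power V a"
proof (rule mfps_eqI)
  fix b
  have "mfps_coeff (vec_power V a) b = 0" if "\<not> total_degree a \<le> total_degree b"
    using vanishes_below_vec_power[OF assms, of a] that by (simp add: vanishes_below_def)
  then show "mfps_coeff (mfps_subst (mfps_const c * mfps_monom a) V) b =
      mfps_coeff (mfps_const c * vec_power V a) b"
    by (auto simp: finite_total_degree_le mfps_coeff_subst[OF assms] mfps_coeff_monom if_distrib[of "\<lambda>x. _ * x"]
        if_distrib[of "\<lambda>x. x * _"] cong: if_cong)
qed

lemma mfps_subst_const: "order_ge 1 V \<Longrightarrow> mfps_subst (mfps_const c) V = mfps_const c"
  using mfps_subst_monom[of V c 0] by (simp add: mfps_monom_0)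

lemma mfps_subst_var: "order_ge 1 V \<Longrightarrow> mfps_subst (mfps_var i) V = V $ i"
  using mfps_subst_monom[of V 1 "axis i 1"] by (simp add: mfps_monom_axis)

text \<open>
  Both sides are additive and order-preserving in \<open>f\<close> and in \<open>g\<close>, so density reduces the claim to two
  monomials, where it is the law \<open>V\<^bsup>a+b\<^esup> = V\<^sup>a V\<^sup>b\<close>.
\<close>

lemma mfps_subst_mult:
  fixes V :: "(('a::comm_ring_1, 'k::finite) mfps) ^ 'n::finite"
  assumes V: "order_ge 1 V"
  shows "mfps_subst (f * g) V = mfps_subst f V * mfps_subst g V"
proof -
  show ?thesis
  proof (rule mfps_operator_eqI_monom[where f = f])
    fix c a
    let ?m = "mfps_const c * mfps_monom a :: ('a, 'n) mfps"
    show "mfps_subst (?m * g) V = mfps_subst ?m V * mfps_subst g V"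
    proof (rule mfps_operator_eqI_monom[where f = g])
      fix c' a'
      let ?m' = "mfps_const c' * mfps_monom a' :: ('a, 'n) mfps"
      have prod: "?m * ?m' = mfps_const (c * c') * mfps_monom (a + a')"
        by (simp add: mfps_monom_add mfps_const_mult ac_simps)
      show "mfps_subst (?m * ?m') V = mfps_subst ?m V * mfps_subst ?m' V"
        by (simp only: prod mfps_subst_monom[OF V] vec_power_add) (simp only: mfps_const_mult ac_simps)
    qed (auto simp: distrib_left mfps_subst_add[OF V]
        intro!: vanishes_below_subst[OF V] vanishes_below_mult_right elim: vanishes_below_mono)
  qed (auto simp: distrib_right mfps_subst_add[OF V]
      intro!: vanishes_below_subst[OF V] vanishes_below_mult_left elim: vanishes_below_mono)
qed

lemma formal_compose_nth [simp]: "formal_compose U V $ i = mfps_subst (U $ i) V"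
  by (simp add: formal_compose_def)

lemma order_ge_formal_id: "order_ge 1 formal_id"
  by (auto simp: order_ge_def formal_id_def mfps_var_def split: if_splits)

lemma mfps_subst_formal_id: "mfps_subst f formal_id = f"
proof (rule mfps_eqI)
  fix b
  show "mfps_coeff (mfps_subst f formal_id) b = mfps_coeff f b"
    by (simp add: finite_total_degree_le mfps_coeff_subst order_ge_formal_id vec_power_formal_id mfps_coeff_monom
        if_distrib[of "\<lambda>x. _ * x"] cong: if_cong)
qed

lemma order_ge_formal_compose:
  "order_ge 1 W \<Longrightarrow> order_ge d V \<Longrightarrow> order_ge d (formal_compose V W)"
  by (simp add: order_ge_iff_vanishes_below vanishes_below_subst)

text \<open>
  Both sides are ring homomorphisms in \<open>f\<close> that agree on constants and variables, hence on all
  series by density.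
\<close>

lemma mfps_subst_subst:
  fixes V :: "(('a::comm_ring_1, 'k::finite) mfps) ^ 'n::finite"
    and W :: "(('a, 'l::finite) mfps) ^ 'k"
  assumes V: "order_ge 1 V" and W: "order_ge 1 W"
  shows "mfps_subst (mfps_subst f V) W = mfps_subst f (formal_compose V W)"
proof -
  have VW: "order_ge 1 (formal_compose V W)"
    by (rule order_ge_formal_compose[OF W V])
  note order = vanishes_below_subst[OF V] vanishes_below_subst[OF W] vanishes_below_subst[OF VW]
  show ?thesis
    by (rule mfps_operator_eqI[where f = f])
      (auto simp: mfps_subst_add mfps_subst_const mfps_subst_mult V W VW mfps_subst_var
        intro!: order elim: vanishes_below_mono)
qed

lemma formal_compose_assoc:
  "order_ge 1 V \<Longrightarrow> order_ge 1 W \<Longrightarrow>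
    formal_compose (formal_compose U V) W = formal_compose U (formal_compose V W)"
  by (simp add: vec_eq_iff mfps_subst_subst)

lemma formal_compose_id_left: "order_ge 1 V \<Longrightarrow> formal_compose formal_id V = V"
  by (simp add: formal_id_def vec_eq_iff mfps_subst_var)

lemma formal_compose_id_right: "formal_compose U formal_id = U"
  by (simp add: vec_eq_iff mfps_subst_formal_id)

section \<open>Derivations and the chain rule\<close>

lemma mfps_deriv_add: "mfps_deriv i (f + g) = mfps_deriv i f + mfps_deriv i g"
  by (rule mfps_eqI) (simp add: mfps_coeff_deriv distrib_left)

lemma mfps_deriv_const: "mfps_deriv i (mfps_const c) = 0"
  by (rule mfps_eqI) (auto simp: mfps_coeff_deriv mfps_const_def vec_eq_iff axis_def)

lemma mfps_deriv_var: "mfps_deriv i (mfps_var j) = (if i = j then 1 else 0)"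
proof (rule mfps_eqI)
  fix a :: "nat ^ 'b"
  have "a + axis i 1 = axis j 1 \<longleftrightarrow> i = j \<and> a = 0"
  proof
    assume eq: "a + axis i 1 = axis j (1 :: nat)"
    then have "total_degree a + 1 = 1"
      by (metis total_degree_add total_degree_axis)
    then have a: "a = 0" by (simp add: total_degree_def vec_eq_iff)
    with eq show "i = j \<and> a = 0"
      by (auto simp: axis_eq_axis)
  qed auto
  then show "mfps_coeff (mfps_deriv i (mfps_var j) :: ('a, 'b) mfps) a =
      mfps_coeff (if i = j then 1 else 0) a"
    by (auto simp: mfps_coeff_deriv mfps_var_def one_mfps_def)
qed

text \<open>
  On a pair of monomials with \<open>a + b = c + e\<^sub>i\<close> the differentiated factor \<open>c\<^sub>i + 1\<close> splits as
  \<open>a\<^sub>i + b\<^sub>i\<close>; the two parts, after shifting the exponent by \<open>e\<^sub>i\<close>, are the two Leibniz terms.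
\<close>

lemma mfps_deriv_mult:
  "mfps_deriv i (f * g) = mfps_deriv i f * g + f * mfps_deriv i g"
proof (rule mfps_eqI)
  fix c
  let ?e = "axis i 1 :: nat ^ 'b"
  (* Pairs with a $ i = 0 contribute nothing; on the others the shift of a by e is a bijection. *)
  have half: "(\<Sum>(a, b)\<in>splittings (c + ?e). of_nat (a $ i) * (mfps_coeff f a * mfps_coeff g b)) =
      mfps_coeff (mfps_deriv i f * g) c" for f g :: "('a, 'b) mfps"
  proof -
    have shift: "a - ?e + ?e = a" if "0 < a $ i" for a :: "nat ^ 'b"
      using that by (auto simp: vec_eq_iff axis_def)
    have "(\<Sum>(a, b)\<in>splittings (c + ?e). of_nat (a $ i) * (mfps_coeff f a * mfps_coeff g b)) =
        (\<Sum>(a, b)\<in>{p \<in> splittings (c + ?e). 0 < fst p $ i}.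
          of_nat (a $ i) * (mfps_coeff f a * mfps_coeff g b))"
      by (rule sum.mono_neutral_right) (auto intro!: gr0I)
    also have "\<dots> = mfps_coeff (mfps_deriv i f * g) c"
      unfolding mfps_coeff_mult
    proof (rule sum.reindex_bij_witness[of _ "\<lambda>(a, b). (a + ?e, b)" "\<lambda>(a, b). (a - ?e, b)"])
      fix p assume p: "p \<in> {p \<in> splittings (c + ?e). 0 < fst p $ i}"
      obtain a b where ab: "p = (a, b)" by (cases p)
      have "a - ?e + b + ?e = c + ?e"
        using p shift[of a] by (simp add: ab splittings_def ac_simps)
      then have "a - ?e + b = c" by simp
      then show "(case p of (a, b) \<Rightarrow> (a - ?e, b)) \<in> splittings c"
        by (simp add: ab splittings_def)
      show "(case case p of (a, b) \<Rightarrow> (a - ?e, b) of (a, b) \<Rightarrow> (a + ?e, b)) = p"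
        using p shift[of a] by (simp add: ab)
      show "(case case p of (a, b) \<Rightarrow> (a - ?e, b) of
            (a, b) \<Rightarrow> mfps_coeff (mfps_deriv i f) a * mfps_coeff g b) =
          (case p of (a, b) \<Rightarrow> of_nat (a $ i) * (mfps_coeff f a * mfps_coeff g b))"
        using p shift[of a]
        by (auto simp add: ab mfps_coeff_deriv mult.assoc simp flip: of_nat_Suc)
    next
      fix p assume "p \<in> splittings c"
      then show "(case case p of (a, b) \<Rightarrow> (a + ?e, b) of (a, b) \<Rightarrow> (a - ?e, b)) = p"
        "(case p of (a, b) \<Rightarrow> (a + ?e, b)) \<in> {p \<in> splittings (c + ?e). 0 < fst p $ i}"
        by (auto simp: splittings_def ac_simps)
    qed
    finally show ?thesis .
  qed
  have swap: "(\<Sum>(a, b)\<in>splittings d. h a b) = (\<Sum>(a, b)\<in>splittings d. h b a)"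
    for h :: "nat ^ 'b \<Rightarrow> nat ^ 'b \<Rightarrow> 'a" and d
    by (rule sum.reindex_bij_witness[of _ prod.swap prod.swap])
      (auto simp: splittings_def add.commute)
  have "mfps_coeff (mfps_deriv i (f * g)) c =
      (\<Sum>(a, b)\<in>splittings (c + ?e). of_nat ((c + ?e) $ i) * (mfps_coeff f a * mfps_coeff g b))"
    by (simp add: mfps_coeff_deriv mfps_coeff_mult sum_distrib_left case_prod_unfold)
  also have "\<dots> = (\<Sum>(a, b)\<in>splittings (c + ?e).
      of_nat (a $ i) * (mfps_coeff f a * mfps_coeff g b) +
      of_nat (b $ i) * (mfps_coeff g b * mfps_coeff f a))"
    by (rule sum.cong) (auto simp: splittings_def algebra_simps simp flip: of_nat_add vector_add_component
          distrib_left)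
  also have "\<dots> = mfps_coeff (mfps_deriv i f * g) c + mfps_coeff (mfps_deriv i g * f) c"
    using swap[of "\<lambda>a b. of_nat (b $ i) * (mfps_coeff g b * mfps_coeff f a)" "c + ?e"]
    by (simp add: case_prod_unfold sum.distrib flip: half)
  finally show "mfps_coeff (mfps_deriv i (f * g)) c =
      mfps_coeff (mfps_deriv i f * g + f * mfps_deriv i g) c"
    by (simp add: mult.commute)
qed

definition mfps_map :: "('a \<Rightarrow> 'b) \<Rightarrow> ('a, 'n::finite) mfps \<Rightarrow> ('b, 'n) mfps" where
  "mfps_map h f = Abs_mfps (\<lambda>a. h (mfps_coeff f a))"

lemma mfps_coeff_map [simp]: "mfps_coeff (mfps_map h f) a = h (mfps_coeff f a)"
  by (simp add: mfps_map_def)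

text \<open>
  Differentiation with respect to the parameter \<open>t\<close>, the variable of the coefficient polynomials.
\<close>

abbreviation mfps_pderiv :: "('a::field poly, 'n::finite) mfps \<Rightarrow> ('a poly, 'n) mfps" where
  "mfps_pderiv \<equiv> mfps_map pderiv"

lemma mfps_pderiv_add: "mfps_pderiv (f + g) = mfps_pderiv f + mfps_pderiv g"
  by (rule mfps_eqI) (simp add: pderiv_add)

lemma mfps_pderiv_diff: "mfps_pderiv (f - g) = mfps_pderiv f - mfps_pderiv g"
  by (rule mfps_eqI) (simp add: pderiv_diff)

lemma mfps_pderiv_const: "mfps_pderiv (mfps_const c) = mfps_const (pderiv c)"
  by (rule mfps_eqI) (simp add: mfps_const_def)

lemma mfps_pderiv_var: "mfps_pderiv (mfps_var i) = 0"
  by (rule mfps_eqI) (simp add: mfps_var_def)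

lemma mfps_pderiv_mult: "mfps_pderiv (f * g) = mfps_pderiv f * g + f * mfps_pderiv g"
proof (rule mfps_eqI)
  fix c
  have "pderiv (x * y) = pderiv x * y + x * pderiv y" for x y :: "'a poly"
    by (simp add: pderiv_mult)
  then show "mfps_coeff (mfps_pderiv (f * g)) c =
      mfps_coeff (mfps_pderiv f * g + f * mfps_pderiv g) c"
    by (simp add: mfps_coeff_mult case_prod_unfold sum.distrib
        higher_pderiv_sum[of "Suc 0", simplified])
qed

lemma vanishes_below_pderiv: "vanishes_below d f \<Longrightarrow> vanishes_below d (mfps_pderiv f)"
  by (simp add: vanishes_below_def)

text \<open>
  The parameter enters \<open>f(V)\<close> both through the coefficients of \<open>f\<close> and through \<open>V\<close>, whence the
  two kinds of terms. By density it suffices to see that both sides are derivations along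
  substitution of \<open>V\<close> and agree on constants and variables. The derivatives of \<open>f\<close> on the right
  lower the order by one.
\<close>

lemma mfps_pderiv_subst:
  fixes V :: "(('a::field poly, 'k::finite) mfps) ^ 'n::finite"
  assumes V: "order_ge 1 V"
  shows "mfps_pderiv (mfps_subst f V) = mfps_subst (mfps_pderiv f) V +
    (\<Sum>i\<in>UNIV. mfps_subst (mfps_deriv i f) V * mfps_pderiv (V $ i))"
proof (rule mfps_operator_eqI[where f = f])
  fix f :: "('a poly, 'n) mfps" and d
  assume f: "vanishes_below (Suc d) f"
  then have f': "vanishes_below d f" by (rule vanishes_below_mono) simp
  show "vanishes_below d (mfps_pderiv (mfps_subst f V))"
    by (intro vanishes_below_pderiv vanishes_below_subst V f')
  show "vanishes_below d (mfps_subst (mfps_pderiv f) V +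
      (\<Sum>i\<in>UNIV. mfps_subst (mfps_deriv i f) V * mfps_pderiv (V $ i)))"
    by (intro vanishes_below_add vanishes_below_sum vanishes_below_mult_left
        vanishes_below_pderiv vanishes_below_subst vanishes_below_deriv V f f')
next
  fix i
  show "mfps_pderiv (mfps_subst (mfps_var i) V) = mfps_subst (mfps_pderiv (mfps_var i)) V +
      (\<Sum>j\<in>UNIV. mfps_subst (mfps_deriv j (mfps_var i)) V * mfps_pderiv (V $ j))"
  proof -
    have "mfps_subst (mfps_deriv j (mfps_var i)) V * mfps_pderiv (V $ j) =
        (if j = i then mfps_pderiv (V $ i) else 0)" for j
      using mfps_subst_const[OF V, of 1] by (simp add: mfps_deriv_var)
    then show ?thesis by (simp add: mfps_subst_var[OF V] mfps_pderiv_var)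
  qed
qed (simp_all add: mfps_subst_add[OF V] mfps_pderiv_add mfps_deriv_add mfps_deriv_const
    mfps_pderiv_const mfps_subst_const[OF V] mfps_subst_mult[OF V] mfps_pderiv_mult
    mfps_deriv_mult sum.distrib sum_distrib_left sum_distrib_right algebra_simps)

section \<open>Change of the coefficient ring\<close>

text \<open>
  Used for the specializations \<open>t = 0\<close> and \<open>t = 1\<close>: only finitely many terms contribute to a
  coefficient of \<open>f(V)\<close>, so evaluating the parameter commutes with substitution.
\<close>

lemma mfps_map_subst:
  fixes h :: "'a::comm_ring_1 \<Rightarrow> 'b::comm_ring_1"
    and V :: "(('a, 'k::finite) mfps) ^ 'n::finite"
  assumes add: "\<And>x y. h (x + y) = h x + h y" and mult: "\<And>x y. h (x * y) = h x * h y"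
    and one: "h 1 = 1" and V: "order_ge 1 V"
  shows "mfps_map h (mfps_subst f V) = mfps_subst (mfps_map h f) (\<chi> i. mfps_map h (V $ i))"
proof -
  have "Modules.additive h" by (simp add: Modules.additive_def add)
  note zero = Modules.additive.zero[OF this] and sum = Modules.additive.sum[OF this]
  have map_one: "mfps_map h (1 :: ('a, 'k) mfps) = 1"
    by (rule mfps_eqI) (simp add: one_mfps_def zero one)
  have map_mult: "mfps_map h (f * g) = mfps_map h f * mfps_map h g" for f g :: "('a, 'k) mfps"
    by (rule mfps_eqI) (simp add: mfps_coeff_mult sum mult case_prod_unfold)
  have map_pow: "mfps_map h (f ^ n) = mfps_map h f ^ n" for f :: "('a, 'k) mfps" and n
    by (induction n) (simp_all add: map_one map_mult)
  have map_prod: "mfps_map h (prod g S) = (\<Prod>x\<in>S. mfps_map h (g x))"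
    for g :: "'n \<Rightarrow> ('a, 'k) mfps" and S
    by (induction S rule: infinite_finite_induct) (simp_all add: map_one map_mult)
  have vp: "mfps_map h (vec_power V a) = vec_power (\<chi> i. mfps_map h (V $ i)) a" for a
    by (simp add: vec_power_def map_prod map_pow)
  have hV: "order_ge 1 (\<chi> i. mfps_map h (V $ i))"
    using V by (simp add: order_ge_iff_vanishes_below vanishes_below_def zero)
  show ?thesis
    by (rule mfps_eqI) (simp add: mfps_coeff_subst V hV sum mult flip: vp)
qed

lemma mfps_map_coeff_mult:
  fixes f g :: "('a::comm_ring_1 poly, 'n::finite) mfps"
  shows "mfps_map (\<lambda>p. poly.coeff p m) (f * g) =
    (\<Sum>k\<le>m. mfps_map (\<lambda>p. poly.coeff p k) f * mfps_map (\<lambda>p. poly.coeff p (m - k)) g)"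
proof (rule mfps_eqI)
  fix c
  show "mfps_coeff (mfps_map (\<lambda>p. poly.coeff p m) (f * g)) c = mfps_coeff
      (\<Sum>k\<le>m. mfps_map (\<lambda>p. poly.coeff p k) f * mfps_map (\<lambda>p. poly.coeff p (m - k)) g) c"
    by (simp add: mfps_coeff_mult coeff_sum coeff_mult case_prod_unfold sum.swap[of _ "{..m}"])
qed

lemma mfps_map_sum:
  fixes h :: "'a::comm_ring_1 \<Rightarrow> 'b::comm_ring_1"
  assumes "\<And>x y. h (x + y) = h x + h y"
  shows "mfps_map h (sum f S) = (\<Sum>x\<in>S. mfps_map h (f x))"
proof (rule mfps_eqI)
  fix a
  have "Modules.additive h" by (simp add: Modules.additive_def assms)
  then show "mfps_coeff (mfps_map h (sum f S)) a = mfps_coeff (\<Sum>x\<in>S. mfps_map h (f x)) a"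
    by (simp add: Modules.additive.sum)
qed

lemma mfps_map_coeff_deriv:
  "mfps_map (\<lambda>p. poly.coeff p m) (mfps_deriv i f) = mfps_deriv i (mfps_map (\<lambda>p. poly.coeff p m) f)"
  by (rule mfps_eqI) (simp add: mfps_coeff_deriv of_nat_poly del: of_nat_Suc of_nat_add)

lemma mfps_map_coeff_pderiv:
  "mfps_map (\<lambda>p. poly.coeff p m) (mfps_pderiv f) =
    mfps_const (of_nat (Suc m)) * mfps_map (\<lambda>p. poly.coeff p (Suc m)) f"
  by (rule mfps_eqI) (simp add: coeff_pderiv)

lemma mfps_map_coeff_eqI:
  "(\<And>m. mfps_map (\<lambda>p. poly.coeff p m) f = mfps_map (\<lambda>p. poly.coeff p m) g) \<Longrightarrow> f = g"
  by (simp add: mfps_eq_iff poly_eq_iff)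

text \<open>
  The equation determines \<open>m + 1\<close> times the coefficient of \<open>t\<^bsup>m+1\<^esup>\<close> in \<open>Z\<close> as a linear expression
  in the lower ones, and \<open>m + 1\<close> is invertible in characteristic zero; so all of them vanish
  with the initial value.
\<close>

lemma linear_system_unique:
  fixes Z :: "'i::finite \<Rightarrow> ('a::field_char_0 poly, 'n::finite) mfps"
  assumes ode: "\<And>i. mfps_pderiv (Z i) = (\<Sum>j\<in>UNIV. A i j * Z j)"
    and init: "\<And>i. mfps_map (\<lambda>p. poly.coeff p 0) (Z i) = 0"
  shows "Z i = 0"
proof -
  have "mfps_map (\<lambda>p. poly.coeff p m) (Z i) = 0" for m i
  proof (induction m arbitrary: i rule: less_induct)
    case (less m)
    show ?case
    proof (cases m)
      case (Suc k)
      have "mfps_const (of_nat (Suc k)) * mfps_map (\<lambda>p. poly.coeff p (Suc k)) (Z i) =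
          mfps_map (\<lambda>p. poly.coeff p k) (\<Sum>j\<in>UNIV. A i j * Z j)"
        by (simp only: ode flip: mfps_map_coeff_pderiv)
      also have "\<dots> = (\<Sum>j\<in>UNIV. \<Sum>l\<le>k. mfps_map (\<lambda>p. poly.coeff p l) (A i j) *
          mfps_map (\<lambda>p. poly.coeff p (k - l)) (Z j))"
        by (simp add: mfps_map_sum mfps_map_coeff_mult)
      also have "\<dots> = 0"
        by (intro sum.neutral ballI) (simp add: less Suc)
      finally have "of_nat (Suc k) * poly.coeff (mfps_coeff (Z i) a) (Suc k) = 0" for a
        by (metis mfps_coeff_arith(1) mfps_coeff_const_mult mfps_coeff_map)
      then show ?thesis
        by (simp add: mfps_eq_iff Suc del: of_nat_Suc)
    qed (simp add: init)
  qed
  then show ?thesis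
    by (intro mfps_map_coeff_eqI) (simp, simp add: mfps_eq_iff)
qed

section \<open>The deformed inverse\<close>

text \<open>
  The index is shifted by one against the sequence of the theorem: \<open>inversion_term H m\<close> is
  \<open>N\<^bsub>[m+1]\<^esub>\<close>, so that it belongs to \<open>t\<^sup>m\<close> and the factor \<open>1 / (m - 1)\<close> becomes \<open>1 / Suc p\<close>.
\<close>

fun inversion_term :: "(('a::field_char_0, 'n::finite) mfps) ^ 'n \<Rightarrow> nat \<Rightarrow> (('a, 'n) mfps) ^ 'n"
  where
  "inversion_term H 0 = H"
| "inversion_term H (Suc p) = mfps_const (1 / of_nat (Suc p)) *s
    (\<Sum>k\<le>p. jacobian_matrix (inversion_term H k) *v inversion_term H (p - k))"

lemma inversion_term_Suc_nth:
  "inversion_term H (Suc p) $ i = mfps_const (1 / of_nat (Suc p)) *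
    (\<Sum>k\<le>p. \<Sum>j\<in>UNIV. mfps_deriv j (inversion_term H k $ i) * inversion_term H (p - k) $ j)"
  by (simp add: jacobian_matrix_def matrix_vector_mult_def)

text \<open>
  In \<open>JN\<^bsub>[k]\<^esub> \<cdot> N\<^bsub>[l]\<^esub>\<close> the orders \<open>k + 1\<close> and \<open>l + 1\<close> add up and the derivative costs one,
  leaving \<open>k + l + 1\<close>.
\<close>

lemma order_ge_inversion_term:
  assumes "order_ge 2 H"
  shows "order_ge (m + 2) (inversion_term H m)"
proof (induction m rule: less_induct)
  case (less m)
  show ?case
  proof (cases m)
    case 0
    with assms show ?thesis by (simp add: numeral_2_eq_2)
  next
    case (Suc p)
    have "vanishes_below (m + 2)
        (mfps_deriv j (inversion_term H k $ i) * inversion_term H (p - k) $ j)" if "k \<le> p" for i j k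
    proof -
      have "order_ge (k + 2) (inversion_term H k)" "order_ge (p - k + 2) (inversion_term H (p - k))"
        by (intro less.IH; use that Suc in simp)+
      then have "vanishes_below (Suc (Suc k)) (inversion_term H k $ i)"
        "vanishes_below (p - k + 2) (inversion_term H (p - k) $ j)"
        by (simp_all add: order_ge_iff_vanishes_below)
      then have "vanishes_below (Suc k + (p - k + 2))
          (mfps_deriv j (inversion_term H k $ i) * inversion_term H (p - k) $ j)"
        by (intro vanishes_below_mult vanishes_below_deriv)
      then show ?thesis
        by (rule vanishes_below_mono) (use that Suc in linarith)
    qed
    then show ?thesis
      unfolding order_ge_iff_vanishes_below Suc inversion_term_Suc_nth
      by (intro allI vanishes_below_mult_right[where f = "mfps_const _"] vanishes_below_sum) simp
  qed
qed

text \<open>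
  The series \<open>\<Sum>m. t\<^sup>m N\<^bsub>[m+1]\<^esub>\<close>. Cutting the sum at the total degree of \<open>a\<close> makes each coefficient
  a polynomial in \<open>t\<close>; when \<open>H\<close> has order at least two, the omitted terms are zero.
\<close>

definition deformation ::
  "(('a::field_char_0, 'n::finite) mfps) ^ 'n \<Rightarrow> (('a poly, 'n) mfps) ^ 'n" where
  "deformation H = (\<chi> i. Abs_mfps (\<lambda>a.
    \<Sum>m<total_degree a. Polynomial.monom (mfps_coeff (inversion_term H m $ i) a) m))"

lemma coeff_deformation:
  assumes "order_ge 2 H"
  shows "mfps_map (\<lambda>p. poly.coeff p m) (deformation H $ i) = inversion_term H m $ i"
proof (rule mfps_eqI)
  fix a
  have "mfps_coeff (inversion_term H m $ i) a = 0" if "\<not> m < total_degree a"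
    using order_ge_inversion_term[OF assms, of m] that
    by (simp add: order_ge_iff_vanishes_below vanishes_below_def)
  then show "mfps_coeff (mfps_map (\<lambda>p. poly.coeff p m) (deformation H $ i)) a =
      mfps_coeff (inversion_term H m $ i) a"
    by (auto simp: deformation_def coeff_sum)
qed

text \<open>
  The coefficient of \<open>t\<^sup>m\<close> in this equation is the recurrence for \<open>N\<^bsub>[m+2]\<^esub>\<close> multiplied by
  \<open>m + 1\<close>.
\<close>

lemma mfps_pderiv_deformation:
  assumes "order_ge 2 H"
  shows "mfps_pderiv (deformation H $ i) =
    (\<Sum>j\<in>UNIV. mfps_deriv j (deformation H $ i) * deformation H $ j)"
proof (rule mfps_map_coeff_eqI)
  fix m
  have "mfps_map (\<lambda>p. poly.coeff p m) (mfps_pderiv (deformation H $ i)) =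
      mfps_const (of_nat (Suc m)) * inversion_term H (Suc m) $ i"
    by (simp only: mfps_map_coeff_pderiv coeff_deformation[OF assms])
  also have "\<dots> = (\<Sum>k\<le>m. \<Sum>j\<in>UNIV.
      mfps_deriv j (inversion_term H k $ i) * inversion_term H (m - k) $ j)"
    by (rule mfps_eqI) (simp add: inversion_term_Suc_nth del: inversion_term.simps of_nat_Suc)
  also have "\<dots> = (\<Sum>j\<in>UNIV. \<Sum>k\<le>m.
      mfps_deriv j (inversion_term H k $ i) * inversion_term H (m - k) $ j)"
    by (rule sum.swap)
  also have "\<dots> = mfps_map (\<lambda>p. poly.coeff p m)
      (\<Sum>j\<in>UNIV. mfps_deriv j (deformation H $ i) * deformation H $ j)"
    by (simp add: mfps_map_sum mfps_map_coeff_mult mfps_map_coeff_deriv coeff_deformation[OF assms])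
  finally show "mfps_map (\<lambda>p. poly.coeff p m) (mfps_pderiv (deformation H $ i)) =
      mfps_map (\<lambda>p. poly.coeff p m)
      (\<Sum>j\<in>UNIV. mfps_deriv j (deformation H $ i) * deformation H $ j)" .
qed

section \<open>Specialization of the parameter\<close>

definition inversion_sum ::
  "(('a::field_char_0, 'n::finite) mfps) ^ 'n \<Rightarrow> (('a, 'n) mfps) ^ 'n" where
  "inversion_sum H = (\<chi> i. mfps_map (\<lambda>p. poly p 1) (deformation H $ i))"

lemma mfps_coeff_inversion_sum:
  "mfps_coeff (inversion_sum H $ i) a =
    (\<Sum>m<total_degree a. mfps_coeff (inversion_term H m $ i) a)"
  by (simp add: inversion_sum_def deformation_def poly_sum poly_monom)

lemma order_ge_inversion_sum:
  assumes "order_ge 2 H"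
  shows "order_ge 2 (inversion_sum H)"
  using order_ge_inversion_term[OF assms]
  by (auto simp: order_ge_iff_vanishes_below vanishes_below_def mfps_coeff_inversion_sum
      intro!: sum.neutral)

lemma order_ge_formal_id_diff:
  assumes "order_ge 2 H"
  shows "order_ge 1 (formal_id - H)"
  using assms order_ge_formal_id
  by (auto simp: order_ge_iff_vanishes_below vanishes_below_def)

text \<open>
  The discrepancy \<open>Z\<^sub>t = N\<^sub>t(z - t H) - H\<close> satisfies \<open>\<partial>Z\<^sub>t/\<partial>t = JN\<^sub>t(z - t H) \<cdot> Z\<^sub>t\<close> and is zero at
  \<open>t = 0\<close>, hence also at \<open>t = 1\<close>.
\<close>

lemma inversion_sum_left_inverse:
  fixes H :: "(('a::field_char_0, 'n::finite) mfps) ^ 'n"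
  assumes H: "order_ge 2 H"
  shows "formal_compose (formal_id + inversion_sum H) (formal_id - H) = formal_id"
proof -
  define lift :: "('a, 'n) mfps \<Rightarrow> ('a poly, 'n) mfps" where "lift = mfps_map (\<lambda>c. [:c:])"
  define Ft where "Ft = (\<chi> i. mfps_var i - mfps_const [:0, 1:] * lift (H $ i))"
  have Ft_order: "order_ge 1 Ft"
    using H order_ge_formal_id
    by (auto simp: order_ge_iff_vanishes_below Ft_def formal_id_def lift_def vanishes_below_def)
  have lift_deriv: "mfps_pderiv (lift f) = 0" for f
    by (rule mfps_eqI) (simp add: lift_def pderiv_pCons)
  have Ft_deriv: "mfps_pderiv (Ft $ i) = - lift (H $ i)" for i
    by (simp add: Ft_def mfps_pderiv_diff mfps_pderiv_var mfps_pderiv_mult lift_deriv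
        mfps_pderiv_const pderiv_pCons one_pCons[symmetric])
  have Ft_eval: "mfps_map (\<lambda>p. poly p t) (Ft $ i) = mfps_var i - mfps_const t * H $ i" for t i
    by (rule mfps_eqI) (simp add: Ft_def lift_def mfps_var_def)
  define Z where "Z i = mfps_subst (deformation H $ i) Ft - lift (H $ i)" for i
  have "mfps_pderiv (Z i) = (\<Sum>j\<in>UNIV. mfps_subst (mfps_deriv j (deformation H $ i)) Ft * Z j)" for i
    by (simp add: Z_def mfps_pderiv_diff lift_deriv mfps_pderiv_subst[OF Ft_order] Ft_deriv
        mfps_pderiv_deformation[OF H] mfps_subst_sum[OF Ft_order] mfps_subst_mult[OF Ft_order]
        right_diff_distrib sum_subtractf sum_negf)
  moreover have "mfps_map (\<lambda>p. poly.coeff p 0) (Z i) = 0" for i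
  proof -
    have "(\<chi> j. mfps_map (\<lambda>p. poly p 0) (Ft $ j)) = formal_id"
      by (simp add: Ft_eval formal_id_def)
    moreover have "mfps_map (\<lambda>p. poly p 0) (deformation H $ i) = H $ i"
      using coeff_deformation[OF H, of 0 i] by (simp add: poly_0_coeff_0)
    ultimately have "mfps_map (\<lambda>p. poly p 0) (mfps_subst (deformation H $ i) Ft) = H $ i"
      by (simp add: mfps_map_subst Ft_order mfps_subst_formal_id)
    then show ?thesis
      by (simp add: Z_def mfps_eq_iff poly_0_coeff_0 lift_def)
  qed
  ultimately have "Z i = 0" for i
    by (rule linear_system_unique)
  then have "mfps_map (\<lambda>p. poly p 1) (mfps_subst (deformation H $ i) Ft) = H $ i" for i
    by (simp add: Z_def mfps_eq_iff lift_def)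
  moreover have "(\<chi> j. mfps_map (\<lambda>p. poly p 1) (Ft $ j)) = formal_id - H"
    by (simp add: Ft_eval formal_id_def vec_eq_iff)
  ultimately have "mfps_subst (inversion_sum H $ i) (formal_id - H) = H $ i" for i
    by (simp add: mfps_map_subst Ft_order inversion_sum_def)
  then show ?thesis
    using order_ge_formal_id_diff[OF H]
    by (simp add: vec_eq_iff mfps_subst_add formal_id_def mfps_subst_var)
qed

text \<open>
  With \<open>G\<close> the left inverse of \<open>F\<close> and \<open>K\<close> the left inverse of \<open>G\<close>, \<open>F = (K \<circ> G) \<circ> F = K \<circ> (G \<circ> F) = K\<close>.
\<close>

lemma inversion_sum_right_inverse:
  assumes H: "order_ge 2 H"
  shows "formal_compose (formal_id - H) (formal_id + inversion_sum H) = formal_id"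
proof -
  define H' where "H' = - inversion_sum H"
  define F where "F = formal_id - H"
  define G where "G = formal_id - H'"
  define K where "K = formal_id + inversion_sum H'"
  have H': "order_ge 2 H'"
    using order_ge_inversion_sum[OF H] by (simp add: H'_def order_ge_def)
  have F: "order_ge 1 F" and G: "order_ge 1 G"
    unfolding F_def G_def by (intro order_ge_formal_id_diff H H')+
  have GF: "formal_compose G F = formal_id"
    using inversion_sum_left_inverse[OF H] by (simp add: F_def G_def H'_def)
  have KG: "formal_compose K G = formal_id"
    unfolding K_def G_def by (rule inversion_sum_left_inverse[OF H'])
  have "F = formal_compose (formal_compose K G) F"
    by (simp only: KG formal_compose_id_left[OF F])
  also have "\<dots> = K"
    by (simp only: formal_compose_assoc[OF G F] GF formal_compose_id_right)
  finally show ?thesis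
    using KG by (simp add: F_def G_def H'_def)
qed

lemma formal_inverse_unique:
  assumes "formal_inverse F G" "formal_inverse F G'"
  shows "G = G'"
proof -
  have ord: "order_ge 1 F" "order_ge 1 G" "order_ge 1 G'"
    and eq: "formal_compose F G = formal_id" "formal_compose G' F = formal_id"
    using assms by (simp_all add: formal_inverse_def)
  have "G' = formal_compose G' (formal_compose F G)"
    by (simp only: eq formal_compose_id_right)
  also have "\<dots> = formal_compose (formal_compose G' F) G"
    by (rule formal_compose_assoc[symmetric]) (simp_all add: ord)
  also have "\<dots> = G"
    by (simp only: eq formal_compose_id_left[OF ord(2)])
  finally show ?thesis ..
qed

lemma formal_inverse_inversion_sum:
  assumes H: "order_ge 2 H"
  shows "formal_inverse (formal_id - H) (formal_id + inversion_sum H)"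
proof -
  have "order_ge 2 (- inversion_sum H)"
    using order_ge_inversion_sum[OF H] by (simp add: order_ge_def)
  from order_ge_formal_id_diff[OF this] show ?thesis
    using H by (simp add: formal_inverse_def order_ge_formal_id_diff inversion_sum_left_inverse
        inversion_sum_right_inverse)
qed

section \<open>Convergence\<close>

lemma mfps_tendstoI:
  assumes "\<And>a. eventually (\<lambda>n. mfps_coeff (X n) a = mfps_coeff f a) F"
  shows "(X \<longlongrightarrow> f) F"
proof (rule topological_tendstoI)
  fix U assume "open U" "f \<in> U"
  then obtain d where d:
    "\<And>g. (\<forall>a. total_degree a \<le> d \<longrightarrow> mfps_coeff g a = mfps_coeff f a) \<Longrightarrow> g \<in> U"
    unfolding open_mfps_def by blast
  have "eventually (\<lambda>n. \<forall>a\<in>{a. total_degree a \<le> d}. mfps_coeff (X n) a = mfps_coeff f a) F"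
    by (intro eventually_ball_finite finite_total_degree_le ballI assms)
  then show "eventually (\<lambda>n. X n \<in> U) F"
    by (rule eventually_mono) (use d in auto)
qed

lemma inversion_term_sums:
  assumes H: "order_ge 2 H"
  shows "inversion_term H sums inversion_sum H"
  unfolding sums_def
proof (intro vec_tendstoI mfps_tendstoI)
  fix i a
  (* Terms with m at least the total degree of a have order above it, so the partial sums are
     constant in this coefficient from then on. *)
  have "mfps_coeff ((\<Sum>m<n. inversion_term H m) $ i) a = mfps_coeff (inversion_sum H $ i) a"
    if "total_degree a \<le> n" for n
    unfolding sum_component mfps_coeff_sum mfps_coeff_inversion_sum
    using order_ge_inversion_term[OF H] that
    by (intro sum.mono_neutral_right) (auto simp: order_ge_iff_vanishes_below vanishes_below_def)
  then show "\<forall>\<^sub>F n in sequentially.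
      mfps_coeff ((\<Sum>m<n. inversion_term H m) $ i) a = mfps_coeff (inversion_sum H $ i) a"
    unfolding eventually_sequentially by blast
qed

text \<open>
  Limits of vectors are unique because those of their components are; the product topology enters
  only through the continuity of the projections.
\<close>

lemma vec_sums_unique:
  fixes f :: "nat \<Rightarrow> ('a::{t2_space, comm_monoid_add}) ^ 'n::finite"
  assumes "f sums s"
  shows "suminf f = s"
  unfolding suminf_def
proof (rule the_equality)
  show "f sums s" by (rule assms)
  fix t assume "f sums t"
  show "t = s"
    unfolding vec_eq_iff
  proof
    fix i
    show "t $ i = s $ i"
      using \<open>f sums t\<close> assms unfolding sums_def
      by (rule LIMSEQ_unique[OF tendsto_vec_nth tendsto_vec_nth])
  qed
qed

theorem theorem3p5:
  fixes H :: "((complex, 'n::finite) mfps) ^ 'n"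
    and N :: "nat \<Rightarrow> ((complex, 'n) mfps) ^ 'n"
  assumes "order_ge 2 H"
    and "N 1 = H"
    and "\<And>m. m \<ge> 2 \<Longrightarrow>
      N m = mfps_const (1 / (of_nat m - 1)) *s
        (\<Sum>(k, l)\<in>{(k, l). k + l = m \<and> k \<ge> 1 \<and> l \<ge> 1}. jacobian_matrix (N k) *v N l)"
  shows "summable (\<lambda>m. N (Suc m)) \<and>
    (\<forall>G. formal_inverse (formal_id - H) G \<longleftrightarrow> G = formal_id + (\<Sum>m. N (Suc m)))"
proof -
  have "N (Suc m) = inversion_term H m" for m
  proof (induction m rule: less_induct)
    case (less m)
    show ?case
    proof (cases m)
      case 0
      with assms(2) show ?thesis by (simp add: One_nat_def)
    next
      case (Suc p)
      have pairs: "{(k, l). k + l = Suc m \<and> k \<ge> 1 \<and> l \<ge> 1} = (\<lambda>k. (Suc k, Suc (p - k))) ` {..p}"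
      proof (intro set_eqI iffI)
        fix x assume "x \<in> {(k, l). k + l = Suc m \<and> k \<ge> 1 \<and> l \<ge> 1}"
        then have "x = (Suc (fst x - 1), Suc (p - (fst x - 1)))" "fst x - 1 \<le> p"
          using Suc by (auto simp: prod_eq_iff)
        then show "x \<in> (\<lambda>k. (Suc k, Suc (p - k))) ` {..p}" by blast
      qed (auto simp: Suc)
      have "(\<Sum>(k, l)\<in>{(k, l). k + l = Suc m \<and> k \<ge> 1 \<and> l \<ge> 1}. jacobian_matrix (N k) *v N l) =
          (\<Sum>k\<le>p. jacobian_matrix (N (Suc k)) *v N (Suc (p - k)))"
        unfolding pairs by (subst sum.reindex) (simp_all add: inj_on_def)
      also have "\<dots> = (\<Sum>k\<le>p. jacobian_matrix (inversion_term H k) *v inversion_term H (p - k))"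
        using less Suc by (intro sum.cong) auto
      finally show ?thesis
        using assms(3)[of "Suc m"] Suc by simp
    qed
  qed
  then have sums: "(\<lambda>m. N (Suc m)) sums inversion_sum H"
    using inversion_term_sums[OF assms(1)] by simp
  show ?thesis
    unfolding vec_sums_unique[OF sums]
    using sums_summable[OF sums] formal_inverse_inversion_sum[OF assms(1)]
    by (auto dest: formal_inverse_unique)
qed

end
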